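(* Let $T$ be a tree of order $n\ge 4$ having exactly $s$ non-pendent (internal) vertices, and let $P_n$ be the path on $n$ vertices. If $$\Big(\frac{\pi-2}{\pi}\Big)n\ge s+2-\frac{2s}{n},$$ then $$LE(T)\ge LE(P_n).$$
   Context: For a simple graph $G$ with $n$ vertices and $m$ edges, let $L(G)=D(G)-A(G)$ be its Laplacian matrix ($D(G)$ the diagonal matrix of vertex degrees, $A(G)$ the adjacency matrix), with eigenvalues $\mu_1(G)\ge\mu_2(G)\ge\dots\ge\mu_n(G)=0$ counted with multiplicity. The average degree is $\overline{d}(G)=\frac{2m}{n}$. The Laplacian energy is $LE(G)=\sum_{i=1}^{n}\left|\mu_i(G)-\overline{d}(G)\right|$. A vertex is pendent if its degree is $1$, and non-pendent (internal) otherwise. *)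

theory Defs
  imports
    Complex_Main
    "Jordan_Normal_Form.Char_Poly"
    "Jordan_Normal_Form.Conjugate"
    "Graph_Theory.Graph_Theory"
begin

text \<open>
  A finite simple graph is a \<^locale>\<open>pair_graph\<close>: its arc set is a symmetric irreflexive relation,
  so every undirected edge contributes two arcs, and \<^const>\<open>out_degree\<close> is the vertex degree.
\<close>

section \<open>Trees and paths\<close>

text \<open>
  The library's \<^const>\<open>forest\<close> is not the acyclicity of an undirected graph: in a symmetric digraph
  each edge, traversed back and forth, is a \<^const>\<open>pre_digraph.cycle\<close> of length 2. Since there are no
  loops and no parallel edges, the cycles of the undirected graph are those of length at least 3.
\<close>

definition ugraph_tree :: "'a pair_pre_digraph \<Rightarrow> bool" where
  "ugraph_tree G \<longleftrightarrow>
     pair_graph G \<and> Digraph_Component.connected (with_proj G) \<and>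
     \<not> (\<exists>p. pre_digraph.cycle (with_proj G) p \<and> length p \<ge> 3)"

definition path_graph :: "nat \<Rightarrow> nat pair_pre_digraph" where
  "path_graph n =
     \<lparr> pverts = {0..<n}, parcs = {(i, j). i < n \<and> j < n \<and> (j = Suc i \<or> i = Suc j)} \<rparr>"

definition internal_verts :: "'a pair_pre_digraph \<Rightarrow> 'a set" where
  "internal_verts G = {v \<in> pverts G. out_degree (with_proj G) v \<noteq> 1}"

section \<open>Laplacian matrix and Laplacian energy\<close>

text \<open>The list \<open>xs\<close> enumerates the vertices; row and column \<open>i\<close> belong to \<open>xs ! i\<close>.\<close>

definition degree_mat :: "'a list \<Rightarrow> 'a pair_pre_digraph \<Rightarrow> real mat" where
  "degree_mat xs G = mat (length xs) (length xs)
     (\<lambda>(i, j). if i = j then real (out_degree (with_proj G) (xs ! i)) else 0)"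

definition adjacency_mat :: "'a list \<Rightarrow> 'a pair_pre_digraph \<Rightarrow> real mat" where
  "adjacency_mat xs G = mat (length xs) (length xs)
     (\<lambda>(i, j). if (xs ! i, xs ! j) \<in> parcs G then 1 else 0)"

definition laplacian_mat :: "'a list \<Rightarrow> 'a pair_pre_digraph \<Rightarrow> real mat" where
  "laplacian_mat xs G = degree_mat xs G - adjacency_mat xs G"

definition vertex_enum :: "'a pair_pre_digraph \<Rightarrow> 'a list" where
  "vertex_enum G = (SOME xs. distinct xs \<and> set xs = pverts G)"

text \<open>
  The multiset of Laplacian eigenvalues. It has exactly \<open>card (pverts G)\<close> elements and does not
  depend on the enumeration chosen: see \<open>size_laplacian_spectrum\<close> and \<open>laplacian_spectrum_eq\<close>.
\<close>

definition laplacian_spectrum :: "'a pair_pre_digraph \<Rightarrow> real multiset" where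
  "laplacian_spectrum G = proots (char_poly (laplacian_mat (vertex_enum G) G))"

text \<open>The number of edges is \<open>m = card (parcs G) / 2\<close>.\<close>

definition average_degree :: "'a pair_pre_digraph \<Rightarrow> real" where
  "average_degree G = 2 * (real (card (parcs G)) / 2) / real (card (pverts G))"

definition laplacian_energy :: "'a pair_pre_digraph \<Rightarrow> real" where
  "laplacian_energy G = (\<Sum>\<mu>\<in>#laplacian_spectrum G. \<bar>\<mu> - average_degree G\<bar>)"

section \<open>The spectrum is well defined\<close>

lemma laplacian_mat_carrier [simp]:
  "laplacian_mat xs G \<in> carrier_mat (length xs) (length xs)"
  by (simp add: laplacian_mat_def adjacency_mat_def minus_carrier_mat)

lemma dim_laplacian_mat [simp]:
  "dim_row (laplacian_mat xs G) = length xs" "dim_col (laplacian_mat xs G) = length xs"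
  using laplacian_mat_carrier[of xs G] unfolding carrier_mat_def by auto

lemma laplacian_mat_index:
  "i < length xs \<Longrightarrow> j < length xs \<Longrightarrow> laplacian_mat xs G $$ (i, j) =
     (if i = j then real (out_degree (with_proj G) (xs ! i)) else 0) -
     (if (xs ! i, xs ! j) \<in> parcs G then 1 else 0)"
  by (simp add: laplacian_mat_def degree_mat_def adjacency_mat_def)

lemma vertex_enum:
  assumes "finite (pverts G)"
  shows "distinct (vertex_enum G)" "set (vertex_enum G) = pverts G"
proof -
  have "distinct (vertex_enum G) \<and> set (vertex_enum G) = pverts G"
    unfolding vertex_enum_def
    by (rule someI_ex) (metis assms finite_distinct_list)
  then show "distinct (vertex_enum G)" "set (vertex_enum G) = pverts G" by auto
qed

lemma eigenvalue_real_symmetric: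
  fixes A :: "real mat"
  assumes A: "A \<in> carrier_mat n n" and sym: "transpose_mat A = A"
    and k: "eigenvalue (map_mat complex_of_real A) k"
  shows "k \<in> \<real>"
proof -
  let ?B = "map_mat complex_of_real A"
  have B: "?B \<in> carrier_mat n n" using A by simp
  have symB: "transpose_mat ?B = ?B"
    by (metis sym map_mat_transpose)
  from k obtain v where v: "v \<in> carrier_vec n" "v \<noteq> 0\<^sub>v n" "?B *\<^sub>v v = k \<cdot>\<^sub>v v"
    using A by (auto simp: eigenvalue_def eigenvector_def)
  have w: "conjugate v \<in> carrier_vec n" using v by simp
  have "?B *\<^sub>v conjugate v = conjugate (?B *\<^sub>v v)"
    using A v(1) by (intro eq_vecI) (auto simp: scalar_prod_def)
  also have "\<dots> = cnj k \<cdot>\<^sub>v conjugate v"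
    unfolding v(3) by (intro eq_vecI) auto
  finally have "v \<bullet> (?B *\<^sub>v conjugate v) = cnj k * (v \<bullet> conjugate v)"
    using v(1) w by simp
  moreover have "v \<bullet> (?B *\<^sub>v conjugate v) = (transpose_mat ?B *\<^sub>v v) \<bullet> conjugate v"
    using transpose_vec_mult_scalar[OF B w v(1)] by simp
  moreover have "(transpose_mat ?B *\<^sub>v v) \<bullet> conjugate v = k * (v \<bullet> conjugate v)"
    unfolding symB v(3) using v(1) w by simp
  moreover have "v \<bullet> conjugate v \<noteq> 0"
    using v conjugate_square_eq_0_vec by blast
  ultimately have "cnj k = k" by simp
  then show ?thesis using Reals_cnj_iff by blast
qed

lemma map_poly_of_real_mult:
  "map_poly complex_of_real (p * q) = map_poly complex_of_real p * map_poly complex_of_real q"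
  by (intro poly_eqI) (simp add: coeff_map_poly coeff_mult)

lemma size_proots_char_poly_symmetric:
  fixes A :: "real mat"
  assumes A: "A \<in> carrier_mat n n" and sym: "transpose_mat A = A"
  shows "size (proots (char_poly A)) = n"
proof -
  let ?B = "map_mat complex_of_real A"
  have B: "?B \<in> carrier_mat n n" using A by simp
  obtain as where as: "char_poly ?B = (\<Prod>a\<leftarrow>as. [:- a, 1:])" and len: "length as = n"
    using char_poly_factorized[OF B] by auto
  have "a \<in> \<real>" if "a \<in> set as" for a
  proof -
    have "poly (char_poly ?B) a = 0"
      using that unfolding as by (simp add: poly_prod_list prod_list_zero_iff)
    then show ?thesis
      using eigenvalue_real_symmetric[OF A sym] eigenvalue_root_char_poly[OF B] by blast
  qed
  then have "of_real (Re a) = a" if "a \<in> set as" for a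
    using that by (simp add: of_real_Re)
  then have as': "as = map complex_of_real (map Re as)"
    by (simp add: map_idI)
  define rs where "rs = map Re as"
  have "map_poly complex_of_real (char_poly A) = char_poly ?B"
    by (rule of_real_hom.char_poly_hom[OF A, symmetric])
  also have "\<dots> = (\<Prod>r\<leftarrow>rs. [:- complex_of_real r, 1:])"
    unfolding as by (subst as') (simp add: rs_def o_def)
  also have "\<dots> = map_poly complex_of_real (\<Prod>r\<leftarrow>rs. [:- r, 1:])"
  proof (induction rs)
    case (Cons r rs)
    have "map_poly complex_of_real [:- r, 1:] = [:- complex_of_real r, 1:]"
      by (simp add: map_poly_pCons)
    then show ?case
      by (simp only: list.map prod_list.Cons Cons.IH map_poly_of_real_mult)
  qed simp
  finally have "char_poly A = (\<Prod>r\<leftarrow>rs. [:- r, 1:])"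
    by (simp add: poly_eq_iff coeff_map_poly)
  moreover have "proots (\<Prod>r\<leftarrow>rs. [:- r, 1:]) = mset rs"
  proof (induction rs)
    case (Cons r rs)
    have "(\<Prod>r\<leftarrow>rs. [:- r, 1:]) \<noteq> 0" by (auto simp: prod_list_zero_iff)
    then have "proots ([:- r, 1:] * (\<Prod>r\<leftarrow>rs. [:- r, 1:])) = {#r#} + mset rs"
      by (subst proots_mult) (simp_all add: Cons.IH del: mult_pCons_left)
    then show ?case by (simp del: mult_pCons_left)
  qed simp
  ultimately show ?thesis by (simp add: rs_def len)
qed

lemma laplacian_mat_symmetric:
  assumes "pair_graph G"
  shows "transpose_mat (laplacian_mat xs G) = laplacian_mat xs G"
proof -
  interpret pair_graph G by fact
  have "(u, v) \<in> parcs G \<longleftrightarrow> (v, u) \<in> parcs G" for u v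
    using pair_sym_arcs by (auto simp: symmetric_def dest: symD)
  then show ?thesis
    by (intro eq_matI) (auto simp: laplacian_mat_index)
qed

theorem size_laplacian_spectrum:
  assumes "pair_graph G"
  shows "size (laplacian_spectrum G) = card (pverts G)"
proof -
  interpret pair_graph G by fact
  have "length (vertex_enum G) = card (pverts G)"
    using vertex_enum[OF pair_finite_verts] by (metis distinct_card)
  then show ?thesis
    unfolding laplacian_spectrum_def
    using size_proots_char_poly_symmetric[OF laplacian_mat_carrier laplacian_mat_symmetric[OF assms]]
    by simp
qed

lemma char_poly_laplacian_mat_eq:
  assumes "distinct xs" "distinct ys" "set xs = set ys"
  shows "char_poly (laplacian_mat xs G) = char_poly (laplacian_mat ys G)"
proof -
  obtain p where p: "p permutes {..<length ys}" "permute_list p ys = xs"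
    using assms by (metis mset_eq_permutation set_eq_iff_mset_eq_distinct)
  have len: "length xs = length ys" using assms by (metis distinct_card)
  let ?n = "length ys"
  have pn: "p i < ?n" if "i < ?n" for i
    using p(1) that permutes_in_image by fastforce
  have xi: "xs ! i = ys ! p i" if "i < ?n" for i
    using p that by (metis permute_list_nth)
  have pinj: "p i = p j \<longleftrightarrow> i = j" for i j
    using p(1) permutes_inj by (metis injD)
  let ?X = "char_poly_matrix (laplacian_mat xs G)" and ?Y = "char_poly_matrix (laplacian_mat ys G)"
  have X: "?X \<in> carrier_mat ?n ?n" using laplacian_mat_carrier[of xs G] len by simp
  have Y: "?Y \<in> carrier_mat ?n ?n" by simp
  let ?M = "mat ?n ?n (\<lambda>(i, j). ?Y $$ (i, p j))"
  have p0: "p permutes {0..<?n}" using p(1) by (simp add: atLeast0LessThan)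
  have "?X = mat ?n ?n (\<lambda>(i, j). ?Y $$ (p i, p j))"
  proof (intro eq_matI)
    fix i j assume "i < dim_row (mat ?n ?n (\<lambda>(i, j). ?Y $$ (p i, p j)))"
      "j < dim_col (mat ?n ?n (\<lambda>(i, j). ?Y $$ (p i, p j)))"
    then have ij: "i < ?n" "j < ?n" by auto
    show "?X $$ (i, j) = mat ?n ?n (\<lambda>(i, j). ?Y $$ (p i, p j)) $$ (i, j)"
      using ij pn[OF ij(1)] pn[OF ij(2)]
      by (simp add: char_poly_matrix_def laplacian_mat_index len xi pinj)
  qed (use X in auto)
  also have "\<dots> = mat ?n ?n (\<lambda>(i, j). mat ?n ?n (\<lambda>(i, j). ?Y $$ (i, p j)) $$ (p i, j))"
    by (intro eq_matI) (auto simp: pn)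
  finally have X_eq: "?X = mat ?n ?n (\<lambda>(i, j). mat ?n ?n (\<lambda>(i, j). ?Y $$ (i, p j)) $$ (p i, j))" .
  have "det ?X = signof p * det (mat ?n ?n (\<lambda>(i, j). ?Y $$ (i, p j)))"
    unfolding X_eq by (rule det_permute_rows[OF _ p0]) simp
  also have "det ?M = det (transpose_mat ?M)"
    by (rule det_transpose[symmetric, of _ ?n]) simp
  also have "transpose_mat ?M = mat ?n ?n (\<lambda>(i, j). transpose_mat ?Y $$ (p i, j))"
    by (intro eq_matI) (simp_all add: pn char_poly_matrix_def)
  also have "det \<dots> = signof p * det (transpose_mat ?Y)"
    by (rule det_permute_rows[OF _ p0]) (use Y in simp)
  also have "det (transpose_mat ?Y) = det ?Y"
    by (rule det_transpose[OF Y])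
  finally show ?thesis
    by (simp add: char_poly_def sign_def)
qed

theorem laplacian_spectrum_eq:
  assumes "distinct xs" "set xs = pverts G"
  shows "laplacian_spectrum G = proots (char_poly (laplacian_mat xs G))"
proof -
  have "finite (pverts G)" using assms(2) by (metis List.finite_set)
  then show ?thesis
    unfolding laplacian_spectrum_def
    using char_poly_laplacian_mat_eq[of "vertex_enum G" xs G] vertex_enum assms by metis
qed

end

theory Submission
  imports Defs "Jordan_Normal_Form.Schur_Decomposition"
begin

text \<open>
  The diagonal of a real symmetric matrix is obtained from its eigenvalues by a doubly stochastic
  averaging, so \<open>LE(T)\<close> is at least \<open>\<Sum>\<^sub>v |deg v - d|\<close> for the average degree \<open>d\<close>. Since pendent
  vertices have degree 1 and a connected graph has at least \<open>n - 1\<close> edges, this sum is at least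
  \<open>2(n - s)(1 - 2/n)\<close>, which the hypothesis on \<open>s\<close> makes at least \<open>4n/\<pi>\<close>. On the other hand the
  eigenvalues of the path are \<open>2 - 2 cos(k\<pi>/n)\<close>; with \<open>y = \<pi>/(2n)\<close> this gives
  \<open>LE(P\<^sub>n) = 2 cot y\<close> for even \<open>n\<close> and \<open>2/sin y - 2/n\<close> for odd \<open>n\<close>, and both are at most
  \<open>2/y = 4n/\<pi>\<close>.
\<close>

section \<open>Diagonal and eigenvalues of a real symmetric matrix\<close>

text \<open>Complete \<open>v\<close> to a basis and apply Gram-Schmidt, which keeps its first
  vector; the orthogonal vectors, scaled to length 1, become the columns of \<open>W\<close>. The
  scalar \<open>c\<close> stays open because only the direction of the first column matters for an
  eigenvector.\<close>

lemma orthogonal_mat_exists_with_first_col: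
  fixes v :: "real vec"
  assumes v: "v \<in> carrier_vec n" and v0: "v \<noteq> 0\<^sub>v n"
  obtains W c where "W \<in> carrier_mat n n" "transpose_mat W * W = 1\<^sub>m n" "W * transpose_mat W = 1\<^sub>m n"
    "col W 0 = c \<cdot>\<^sub>v v"
proof -
  interpret cof_vec_space n "TYPE(real)" .
  define ws where "ws = gram_schmidt n (basis_completion v)"
  have n: "n > 0" using v v0 by (cases n) auto
  note bc = basis_completion[OF v v0]
  obtain vs where b: "basis_completion v = v # vs"
    using bc(6,7) n by (cases "basis_completion v") auto
  note gs = gram_schmidt_result[OF bc(2,4,5) refl, folded ws_def]
  have len: "length ws = n" using gs(4) bc(6) by simp
  have hd: "ws ! 0 = v" using gram_schmidt_hd[OF v, of vs] n len unfolding ws_def b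
    by (metis hd_conv_nth length_0_conv less_numeral_extra(3))
  have wc: "ws ! i \<in> carrier_vec n" if "i < n" for i
    using gs(3) that len by auto
  \<comment> \<open>Over the reals conjugation is the identity. The equivalence also yields nonzero
    squared lengths (the case \<open>i = j\<close>), so the factors \<open>f\<close> below normalise
    properly.\<close>
  have orth: "ws ! i \<bullet> ws ! j = 0 \<longleftrightarrow> i \<noteq> j" if "i < n" "j < n" for i j
    using corthogonalD[OF gs(2), of i j] that len by (simp add: conjugate_vec_def map_vec_def)
  define f where "f i = 1 / sqrt (ws ! i \<bullet> ws ! i)" for i
  define W where "W = mat n n (\<lambda>(i, j). f j * (ws ! j $ i))"
  have W: "W \<in> carrier_mat n n" by (simp add: W_def)
  have col: "col W j = f j \<cdot>\<^sub>v ws ! j" if "j < n" for j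
    using that wc[OF that] by (intro eq_vecI) (auto simp: W_def)
  have "transpose_mat W * W = 1\<^sub>m n"
  proof (rule eq_matI)
    fix i j assume "i < dim_row (1\<^sub>m n)" "j < dim_col (1\<^sub>m n)"
    then have ij: "i < n" "j < n" by auto
    have "(transpose_mat W * W) $$ (i, j) = (f i \<cdot>\<^sub>v ws ! i) \<bullet> (f j \<cdot>\<^sub>v ws ! j)"
      using ij W col by simp
    also have "\<dots> = f i * f j * (ws ! i \<bullet> ws ! j)"
      using wc[OF ij(1)] wc[OF ij(2)] by simp
    also have "\<dots> = 1\<^sub>m n $$ (i, j)"
    proof (cases "i = j")
      case True
      have "ws ! i \<bullet> ws ! i \<ge> 0"
        by (simp add: scalar_prod_def sum_nonneg)
      then have "ws ! i \<bullet> ws ! i > 0"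
        using orth[OF ij(1) ij(1)] by (simp add: order_less_le)
      then show ?thesis using True ij by (simp add: f_def)
    next
      case False
      then show ?thesis using orth[OF ij] ij by simp
    qed
    finally show "(transpose_mat W * W) $$ (i, j) = 1\<^sub>m n $$ (i, j)" .
  qed (use W in auto)
  moreover from this have "W * transpose_mat W = 1\<^sub>m n"
    using W by (intro mat_mult_left_right_inverse[of "transpose_mat W"]) auto
  moreover have "col W 0 = f 0 \<cdot>\<^sub>v v" using col[OF n] hd by simp
  ultimately show thesis using that W by blast
qed

text \<open>Deflation, by induction on the list of eigenvalues. With an eigenvector for
  \<open>e\<close> as first column of an orthogonal \<open>W\<close>, the conjugate of
  \<open>A\<close> by \<open>W\<close> splits into the block \<open>e\<close> and a smaller
  symmetric block \<open>C\<close>, whose characteristic polynomial is the product over the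
  remaining list.\<close>

theorem real_symmetric_diagonalization:
  fixes A :: "real mat"
  assumes "A \<in> carrier_mat n n" "transpose_mat A = A" "char_poly A = (\<Prod>e\<leftarrow>es. [:- e, 1:])"
  shows "\<exists>U \<in> carrier_mat n n. transpose_mat U * U = 1\<^sub>m n \<and> U * transpose_mat U = 1\<^sub>m n \<and>
    transpose_mat U * A * U = mat_diag n (\<lambda>i. es ! i)"
  using assms
proof (induction es arbitrary: n A)
  case Nil
  then have "n = 0" using degree_monic_char_poly[OF Nil(1)] by simp
  then show ?case using Nil(1) by (intro bexI[of _ "1\<^sub>m 0"]) (auto simp: mat_diag_def intro!: eq_matI)
next
  case (Cons e es)
  note A = Cons.prems(1) and sym = Cons.prems(2)
  have "eigenvalue A e"
    unfolding eigenvalue_root_char_poly[OF A] Cons.prems(3) by simp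
  then obtain v where v: "v \<in> carrier_vec n" "v \<noteq> 0\<^sub>v n" and Av: "A *\<^sub>v v = e \<cdot>\<^sub>v v"
    using A by (auto simp: eigenvalue_def eigenvector_def)
  obtain m where n: "n = Suc m" using v by (cases n) auto
  obtain W c where W: "W \<in> carrier_mat n n" and WW: "transpose_mat W * W = 1\<^sub>m n"
    "W * transpose_mat W = 1\<^sub>m n" and W0: "col W 0 = c \<cdot>\<^sub>v v"
    using orthogonal_mat_exists_with_first_col[OF v] .
  define B where "B = transpose_mat W * A * W"
  have Wt: "transpose_mat W \<in> carrier_mat n n" and B: "B \<in> carrier_mat n n"
    using W A by (auto simp: B_def)
  have "transpose_mat B = B"
    using W A Wt sym unfolding B_def
    by (simp add: transpose_mult[of _ n n _ n] assoc_mult_mat[of _ n n _ n _ n])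
  then have Bsym: "B $$ (i, j) = B $$ (j, i)" if "i < n" "j < n" for i j
    using that B by (metis carrier_matD index_transpose_mat(1))
  have B0: "B $$ (i, 0) = (if i = 0 then e else 0)" if "i < n" for i
  proof -
    have "B $$ (i, 0) = (transpose_mat W * (A * W)) $$ (i, 0)"
      using W A Wt by (simp add: B_def assoc_mult_mat[of _ n n _ n _ n])
    also have "\<dots> = row (transpose_mat W) i \<bullet> col (A * W) 0"
      using W A that n by (intro index_mult_mat(1)) auto
    also have "row (transpose_mat W) i = col W i" using W that by (intro row_transpose) simp
    also have "col (A * W) 0 = A *\<^sub>v col W 0" using A W n by (intro col_mult2[of _ n n _ n]) auto
    also have "A *\<^sub>v col W 0 = e \<cdot>\<^sub>v col W 0"
      unfolding W0 using A v Av by (simp add: mult_mat_vec[of _ n n] smult_smult_assoc mult.commute)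
    also have "col W i \<bullet> (e \<cdot>\<^sub>v col W 0) = e * (transpose_mat W * W) $$ (i, 0)"
      using W that n by simp
    also have "\<dots> = (if i = 0 then e else 0)" using WW that n by simp
    finally show ?thesis .
  qed
  define C where "C = mat m m (\<lambda>(i, j). B $$ (Suc i, Suc j))"
  have C: "C \<in> carrier_mat m m" by (simp add: C_def)
  \<comment> \<open>The eigenvector determines column 0 of \<open>B\<close>; symmetry then clears
    row 0 as well, so the matrix is block diagonal and not merely block triangular.\<close>
  have Bblock: "B = four_block_mat (mat 1 1 (\<lambda>_. e)) (0\<^sub>m 1 m) (0\<^sub>m m 1) C" (is "_ = ?F")
  proof (rule eq_matI)
    fix i j assume "i < dim_row ?F" "j < dim_col ?F"
    then have ij: "i < n" "j < n" using C n by auto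
    then show "B $$ (i, j) = ?F $$ (i, j)"
      using B0[of i] B0[of j] Bsym[of i j] C n by (cases i; cases j) (auto simp: C_def)
  qed (use B C n in auto)
  have "similar_mat_wit B A (transpose_mat W) W"
    using W A B WW by (intro similar_mat_witI[of _ _ n]) (auto simp: B_def)
  then have "char_poly B = char_poly A"
    by (intro char_poly_similar) (auto simp: similar_mat_def)
  moreover have "char_poly B = char_poly (mat 1 1 (\<lambda>_. e)) * char_poly C"
    unfolding Bblock by (rule char_poly_four_block_zeros_col[OF _ _ C]) auto
  moreover have "char_poly (mat 1 1 (\<lambda>_. e)) = [:- e, 1:]"
    by (simp add: char_poly_defs det_def sign_def)
  ultimately have "[:- e, 1:] * char_poly C = [:- e, 1:] * (\<Prod>e\<leftarrow>es. [:- e, 1:])"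
    using Cons.prems(3) by simp
  then have cpC: "char_poly C = (\<Prod>e\<leftarrow>es. [:- e, 1:])"
    by (metis mult_cancel_left pCons_eq_0_iff zero_neq_one)
  have "transpose_mat C = C"
    using Bsym n by (intro eq_matI) (auto simp: C_def)
  from Cons.IH[OF C this cpC] obtain V where V: "V \<in> carrier_mat m m"
    and VV: "transpose_mat V * V = 1\<^sub>m m" "V * transpose_mat V = 1\<^sub>m m"
    and VC: "transpose_mat V * C * V = mat_diag m (\<lambda>i. es ! i)" by blast
  \<comment> \<open>\<open>Z\<close> lets \<open>V\<close> act on the last \<open>m\<close>
    coordinates and fixes the first, so it diagonalises \<open>C\<close> without disturbing
    \<open>e\<close>.\<close>
  define Z where "Z = four_block_mat (1\<^sub>m 1) (0\<^sub>m 1 m) (0\<^sub>m m 1) V"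
  have Z: "Z \<in> carrier_mat n n" using four_block_carrier_mat[OF _ V, of "1\<^sub>m 1" 1 1] n by (simp add: Z_def)
  have Zt: "transpose_mat Z = four_block_mat (1\<^sub>m 1) (0\<^sub>m 1 m) (0\<^sub>m m 1) (transpose_mat V)"
    unfolding Z_def using V by (subst transpose_four_block_mat) auto
  have Vt: "transpose_mat V \<in> carrier_mat m m" using V by simp
  have VCc: "transpose_mat V * C \<in> carrier_mat m m" using Vt C by simp
  have ZZ: "transpose_mat Z * Z = 1\<^sub>m n" "Z * transpose_mat Z = 1\<^sub>m n"
    unfolding Zt unfolding Z_def using V Vt VV n
    by (simp_all add: mult_four_block_mat[of _ 1 1 _ m _ m _ _ 1 _ m])
  have D1: "transpose_mat Z * B = four_block_mat (mat 1 1 (\<lambda>_. e)) (0\<^sub>m 1 m) (0\<^sub>m m 1) (transpose_mat V * C)"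
    unfolding Zt Bblock using Vt C
    by (subst mult_four_block_mat[of _ 1 1 _ m _ m _ _ 1 _ m]) auto
  have D2: "transpose_mat Z * B * Z =
      four_block_mat (mat 1 1 (\<lambda>_. e)) (0\<^sub>m 1 m) (0\<^sub>m m 1) (mat_diag m (\<lambda>i. es ! i))"
    unfolding D1 unfolding Z_def VC[symmetric] using V VCc
    by (subst mult_four_block_mat[of _ 1 1 _ m _ m _ _ 1 _ m]) auto
  have D: "transpose_mat Z * B * Z = mat_diag n (\<lambda>i. (e # es) ! i)"
    unfolding D2 by (rule eq_matI) (auto simp: mat_diag_def n nth_Cons split: nat.splits)
  have Zt': "transpose_mat Z \<in> carrier_mat n n" using Z by simp
  define U where "U = W * Z"
  have U: "U \<in> carrier_mat n n" using W Z by (simp add: U_def)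
  have Ut: "transpose_mat U = transpose_mat Z * transpose_mat W"
    unfolding U_def using W Z by (simp add: transpose_mult)
  have "transpose_mat U * A * U = transpose_mat Z * B * Z"
    unfolding Ut unfolding U_def B_def using W Wt Z Zt' A
    by (simp add: assoc_mult_mat[of _ n n _ n _ n])
  moreover have "transpose_mat U * U = 1\<^sub>m n"
  proof -
    have "transpose_mat U * U = transpose_mat Z * ((transpose_mat W * W) * Z)"
      unfolding Ut unfolding U_def using W Wt Z Zt' by (simp add: assoc_mult_mat[of _ n n _ n _ n])
    then show ?thesis using WW ZZ Z by simp
  qed
  moreover from this have "U * transpose_mat U = 1\<^sub>m n"
    using U by (intro mat_mult_left_right_inverse[of "transpose_mat U"]) auto
  ultimately show ?case using U D by auto
qed

text \<open>Dividing out one root lowers both the degree and the number of roots by one, so the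
  quotient satisfies the hypotheses again.\<close>

lemma poly_eq_prod_proots_if_splits:
  fixes p :: "'a :: idom poly"
  assumes "monic p" "size (proots p) = degree p"
  shows "p = (\<Prod>x\<in>#proots p. [:- x, 1:])"
  using assms
proof (induction "degree p" arbitrary: p)
  case 0
  then show ?case by (metis monic_degree_0 proots_1 image_mset_empty prod_mset_empty)
next
  case (Suc k)
  then obtain x where x: "x \<in># proots p"
    by (metis multiset_nonemptyE size_empty nat.distinct(1))
  have p0: "p \<noteq> 0" using Suc by auto
  then have "poly p x = 0" using x by simp
  then obtain q where q: "p = [:- x, 1:] * q" by (metis poly_eq_0_iff_dvd dvdE)
  then have q0: "q \<noteq> 0" using p0 by auto
  have pr: "proots p = {#x#} + proots q"
    unfolding q using q0 by (subst proots_mult) auto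
  have deg: "degree p = Suc (degree q)" unfolding q using q0 by (subst degree_mult_eq) auto
  have "monic q" using Suc.prems(1) unfolding q lead_coeff_mult by simp
  from Suc.hyps(1)[OF _ this] have "q = (\<Prod>x\<in>#proots q. [:- x, 1:])"
    using deg Suc pr by simp
  then show ?case unfolding pr using q by simp
qed

text \<open>For orthogonal \<open>U\<close> the squared entries weight the eigenvalues in each
  diagonal entry. Row sums 1 allow \<open>c\<close> to be moved inside the average, where the
  triangle inequality applies; column sums 1 make every eigenvalue count exactly once after the sums
  are swapped.\<close>

theorem sum_abs_diag_le_sum_abs_eigenvalues:
  fixes A :: "real mat" and c :: real
  assumes A: "A \<in> carrier_mat n n" and sym: "transpose_mat A = A"
  shows "(\<Sum>i<n. \<bar>A $$ (i, i) - c\<bar>) \<le> (\<Sum>\<mu>\<in>#proots (char_poly A). \<bar>\<mu> - c\<bar>)"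
proof -
  obtain es where es: "mset es = proots (char_poly A)" by (metis ex_mset)
  have len: "length es = n"
    using size_proots_char_poly_symmetric[OF A sym] es by (metis size_mset)
  have "char_poly A = (\<Prod>x\<in>#mset es. [:- x, 1:])"
    using poly_eq_prod_proots_if_splits[of "char_poly A"] degree_monic_char_poly[OF A]
      size_proots_char_poly_symmetric[OF A sym] es by simp
  also have "\<dots> = (\<Prod>e\<leftarrow>es. [:- e, 1:])"
    by (simp add: prod_mset_prod_list flip: mset_map)
  finally obtain U where U: "U \<in> carrier_mat n n" and UU: "transpose_mat U * U = 1\<^sub>m n"
      "U * transpose_mat U = 1\<^sub>m n"
    and D: "transpose_mat U * A * U = mat_diag n (\<lambda>i. es ! i)"
    using real_symmetric_diagonalization[OF A sym] by metis
  have Ut: "transpose_mat U \<in> carrier_mat n n" using U by simp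
  have "U * mat_diag n (\<lambda>i. es ! i) * transpose_mat U = (U * transpose_mat U) * A * (U * transpose_mat U)"
    unfolding D[symmetric] using U Ut A by (simp add: assoc_mult_mat[of _ n n _ n _ n])
  then have A_eq: "A = U * mat_diag n (\<lambda>i. es ! i) * transpose_mat U" using UU A by simp
  have rows: "(\<Sum>k<n. (U $$ (i, k))\<^sup>2) = 1" if "i < n" for i
    using arg_cong[OF UU(2), of "\<lambda>M. M $$ (i, i)"] that U
    by (simp add: scalar_prod_def power2_eq_square atLeast0LessThan)
  have cols: "(\<Sum>i<n. (U $$ (i, k))\<^sup>2) = 1" if "k < n" for k
    using arg_cong[OF UU(1), of "\<lambda>M. M $$ (k, k)"] that U
    by (simp add: scalar_prod_def power2_eq_square atLeast0LessThan)
  have diag: "A $$ (i, i) = (\<Sum>k<n. (U $$ (i, k))\<^sup>2 * es ! k)" if "i < n" for i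
    using that U by (subst A_eq, subst mat_diag_mult_right[OF U])
      (simp add: scalar_prod_def power2_eq_square atLeast0LessThan mult_ac)
  have "(\<Sum>i<n. \<bar>A $$ (i, i) - c\<bar>) \<le> (\<Sum>i<n. \<Sum>k<n. (U $$ (i, k))\<^sup>2 * \<bar>es ! k - c\<bar>)"
  proof (rule sum_mono)
    fix i assume "i \<in> {..<n}"
    then have i: "i < n" by simp
    have "A $$ (i, i) - c = (\<Sum>k<n. (U $$ (i, k))\<^sup>2 * (es ! k - c))"
      using diag[OF i] rows[OF i]
      by (simp add: right_diff_distrib sum_subtractf flip: sum_distrib_right)
    also have "\<bar>\<dots>\<bar> \<le> (\<Sum>k<n. \<bar>(U $$ (i, k))\<^sup>2 * (es ! k - c)\<bar>)" by (rule sum_abs)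
    finally show "\<bar>A $$ (i, i) - c\<bar> \<le> (\<Sum>k<n. (U $$ (i, k))\<^sup>2 * \<bar>es ! k - c\<bar>)"
      by (simp add: abs_mult)
  qed
  also have "\<dots> = (\<Sum>k<n. \<bar>es ! k - c\<bar>)"
    by (subst sum.swap) (simp add: cols flip: sum_distrib_right)
  also have "\<dots> = (\<Sum>\<mu>\<leftarrow>es. \<bar>\<mu> - c\<bar>)"
    by (simp add: sum_list_sum_nth len atLeast0LessThan)
  also have "\<dots> = (\<Sum>\<mu>\<in>#proots (char_poly A). \<bar>\<mu> - c\<bar>)"
    by (simp add: sum_mset_sum_list flip: es mset_map)
  finally show ?thesis .
qed

section \<open>Trigonometric estimates\<close>

text \<open>The difference of the two sides vanishes at 0 and has derivative
  \<open>t * sin t\<close>. This is the bound cot y <= 1/y needed for even \<open>n\<close>.\<close>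

lemma mult_cos_le_sin:
  fixes x :: real
  assumes "0 \<le> x" "x \<le> pi"
  shows "x * cos x \<le> sin x"
proof -
  have "(\<lambda>x. sin x - x * cos x) 0 \<le> (\<lambda>x. sin x - x * cos x) x"
  proof (rule DERIV_nonneg_imp_nondecreasing[OF assms(1)])
    fix t :: real assume t: "0 \<le> t" "t \<le> x"
    have "((\<lambda>x. sin x - x * cos x) has_real_derivative t * sin t) (at t)"
      by (auto intro!: derivative_eq_intros)
    moreover have "0 \<le> t * sin t" using t assms by (simp add: sin_ge_zero)
    ultimately show "\<exists>y. ((\<lambda>x. sin x - x * cos x) has_real_derivative y) (at t) \<and> 0 \<le> y" by blast
  qed
  then show ?thesis by simp
qed

text \<open>The Dirichlet kernel: each term of the product is a difference of sines at consecutive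
  odd multiples of \<open>x / 2\<close>, so the sum telescopes.\<close>

lemma sum_cos_multiples:
  fixes x :: real
  shows "2 * sin (x / 2) * (\<Sum>k\<le>m. cos (real k * x)) = sin (x / 2) + sin ((2 * real m + 1) * (x / 2))"
proof (induction m)
  case (Suc m)
  have "2 * sin (x / 2) * cos (real (Suc m) * x) =
      sin ((2 * real (Suc m) + 1) * (x / 2)) - sin ((2 * real m + 1) * (x / 2))"
  proof -
    have "(2 * real (Suc m) + 1) * (x / 2) = real (Suc m) * x + x / 2"
      "(2 * real m + 1) * (x / 2) = real (Suc m) * x - x / 2" by (simp_all add: field_simps)
    then show ?thesis by (simp only: sin_add sin_diff) (simp add: algebra_simps)
  qed
  then show ?case using Suc.IH by (simp add: distrib_left)
qed simp

lemma cos_ge_one_minus_square_half: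
  fixes x :: real
  shows "1 - x\<^sup>2 / 2 \<le> cos x"
proof -
  have "(sin (x / 2))\<^sup>2 \<le> (x / 2)\<^sup>2"
    using abs_sin_x_le_abs_x[of "x / 2"] by (metis abs_le_square_iff)
  moreover have "cos x = 1 - 2 * (sin (x / 2))\<^sup>2"
    using cos_double_sin[of "x / 2"] by simp
  ultimately show ?thesis by (simp add: power_divide)
qed

text \<open>Obtained by integrating the quadratic lower bound for the cosine.\<close>

lemma sin_ge_diff_cube:
  fixes y :: real
  assumes "0 \<le> y"
  shows "y - y ^ 3 / 6 \<le> sin y"
proof -
  have "(\<lambda>x. sin x - x + x ^ 3 / 6) 0 \<le> (\<lambda>x. sin x - x + x ^ 3 / 6) y"
  proof (rule DERIV_nonneg_imp_nondecreasing[OF assms])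
    fix t :: real
    have "((\<lambda>x. sin x - x + x ^ 3 / 6) has_real_derivative cos t - 1 + t\<^sup>2 / 2) (at t)"
      by (auto intro!: derivative_eq_intros)
    moreover have "0 \<le> cos t - 1 + t\<^sup>2 / 2" using cos_ge_one_minus_square_half[of t] by simp
    ultimately show "\<exists>y. ((\<lambda>x. sin x - x + x ^ 3 / 6) has_real_derivative y) (at t) \<and> 0 \<le> y" by blast
  qed
  then show ?thesis by simp
qed

text \<open>The sine of pi/6 is 1/2 and is at most pi/6.\<close>

lemma pi_ge_3: "3 \<le> pi"
  using sin_x_le_x[of "pi / 6"] by (simp add: sin_30)

text \<open>The correction \<open>2 * y / pi\<close> is chosen to equal 1/n at y = pi/(2n), the
  slack available for odd \<open>n\<close>. The cubic bound for the sine reduces the claim to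
  \<open>1 \<le> (1 - y\<^sup>2 / 6) * (1 + 2 * y\<^sup>2 / pi)\<close>, which for positive
  \<open>y\<close> amounts to \<open>y\<^sup>2 / 3 \<le> 2 - pi / 6\<close>.\<close>

lemma inverse_sin_le:
  fixes y :: real
  assumes "0 < y" "y \<le> 1 / 2"
  shows "1 / sin y \<le> 1 / y + 2 * y / pi"
proof -
  have y2: "y\<^sup>2 \<le> 1"
    using assms power_mono[of y 1 2] by simp
  have s: "sin y > 0" using assms pi_ge_3 by (intro sin_gt_zero) auto
  have "y\<^sup>2 / 3 \<le> 2 - pi / 6" using y2 pi_less_4 by simp
  then have "y\<^sup>2 * (y\<^sup>2 / 3) \<le> y\<^sup>2 * (2 - pi / 6)" by (intro mult_left_mono) auto
  then have "1 \<le> (1 - y\<^sup>2 / 6) * (1 + 2 * y\<^sup>2 / pi)"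
    by (simp add: field_simps)
  then have "y * 1 \<le> y * ((1 - y\<^sup>2 / 6) * (1 + 2 * y\<^sup>2 / pi))"
    using assms by (intro mult_left_mono) auto
  also have "\<dots> = (y - y ^ 3 / 6) * (1 + 2 * y\<^sup>2 / pi)"
    by (simp add: algebra_simps power2_eq_square power3_eq_cube)
  also have "\<dots> \<le> sin y * (1 + 2 * y\<^sup>2 / pi)"
    using assms by (intro mult_right_mono sin_ge_diff_cube) auto
  finally show ?thesis using s assms by (simp add: field_simps power2_eq_square)
qed

text \<open>The numbers \<open>a k\<close> are the path eigenvalues minus the average degree. They
  sum to 0, so the absolute sum is minus twice the sum of the nonpositive ones; these form an
  initial segment of indices, over which the cosine sum has a closed form.\<close>

lemma path_spectrum_abs_sum_le:
  assumes n: "n \<ge> 4"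
  shows "(\<Sum>k<n. \<bar>2 / real n - 2 * cos (real k * (pi / real n))\<bar>) \<le> 4 * real n / pi"
proof -
  define y where "y = pi / (2 * real n)"
  \<comment> \<open>The last \<open>k\<close> with \<open>2 * k + 1 \<le> n\<close>, that is, with
    angle at most pi/2 - y; every later index has an angle of at least pi/2.\<close>
  define h where "h = (n - 1) div 2"
  define a where "a k = 2 / real n - 2 * cos (real k * (pi / real n))" for k :: nat
  have n0: "real n > 0" using n by simp
  have y: "y > 0" "y \<le> 1 / 2" "pi / real n = 2 * y" "real n * y = pi / 2"
    using n pi_less_4 by (auto simp: y_def field_simps)
  have siny: "sin y > 0" using y pi_ge_3 by (intro sin_gt_zero) auto
  have "h < n" using n by (auto simp: h_def)
  have cosk: "2 * sin y * (\<Sum>k\<le>m. cos (real k * (pi / real n))) = sin y + sin ((2 * real m + 1) * y)" for m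
    using sum_cos_multiples[of "2 * y" m] y(3) by simp
  have total: "(\<Sum>k<n. a k) = 0"
  proof -
    have "(2 * real (n - 1) + 1) * y = pi - y"
      using n y(4) by (simp add: of_nat_diff algebra_simps)
    then have "2 * sin y * (\<Sum>k\<le>n - 1. cos (real k * (pi / real n))) = 2 * sin y"
      using cosk[of "n - 1"] by simp
    moreover have "{..n - 1} = {..<n}" using n by auto
    ultimately have "(\<Sum>k<n. cos (real k * (pi / real n))) = 1" using siny by simp
    then show ?thesis using n0 by (simp add: a_def sum_subtractf flip: sum_distrib_left)
  qed
  have neg: "a k \<le> 0" if "k \<le> h" for k
  proof -
    have "2 * k + 1 \<le> n" using that n by (simp add: h_def)
    then have "2 * real k + 1 \<le> real n" by linarith
    then have "(2 * real k + 1) * y \<le> real n * y" using y by (intro mult_right_mono) auto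
    then have "real k * (pi / real n) \<le> pi / 2 - y" using y(3,4) by (simp add: algebra_simps)
    then have "cos (real k * (pi / real n)) \<ge> cos (pi / 2 - y)"
    proof (intro cos_monotone_0_pi_le)
      show "pi / 2 - y \<le> pi" using y pi_gt_zero by linarith
    qed auto
    also have "cos (pi / 2 - y) = sin y" by (simp add: cos_diff)
    finally have c: "cos (real k * (pi / real n)) \<ge> sin y" .
    \<comment> \<open>It remains to see that \<open>sin y\<close> is at least 1/n. Any factor
      between 2/pi and 1 - 1/24 would serve, since y = pi/(2n) and \<open>y\<^sup>2\<close> is at
      most 1/4; 7/8 is one.\<close>
    have "7 / 8 * y \<le> (1 - y\<^sup>2 / 6) * y"
      using y power_mono[of y "1/2" 2] by (intro mult_right_mono) (auto simp: power2_eq_square)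
    also have "\<dots> = y - y ^ 3 / 6" by (simp add: algebra_simps power2_eq_square power3_eq_cube)
    also have "\<dots> \<le> sin y" using y by (intro sin_ge_diff_cube) auto
    finally have "7 / 8 * y \<le> sin y" .
    moreover have "1 / real n \<le> 7 / 8 * y"
      using n0 pi_ge_3 by (simp add: y_def field_simps)
    ultimately show ?thesis using c by (simp add: a_def)
  qed
  have pos: "a k \<ge> 0" if "h < k" "k < n" for k
  proof -
    have "n \<le> 2 * k" using that by (auto simp: h_def)
    then have "real n \<le> 2 * real k" by linarith
    then have "real n * y \<le> 2 * real k * y" using y by (intro mult_right_mono) auto
    then have 1: "pi / 2 \<le> real k * (pi / real n)" using y(3,4) by (simp add: algebra_simps)
    have "real k * (pi / real n) \<le> pi" using that by (simp add: field_simps)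
    then have "cos (real k * (pi / real n)) \<le> cos (pi / 2)"
      using 1 by (intro cos_monotone_0_pi_le) auto
    moreover have "0 \<le> 2 / real n" by simp
    ultimately show ?thesis unfolding a_def cos_pi_half by linarith
  qed
  have split: "{..<n} = {..h} \<union> {h<..<n}" using \<open>h < n\<close> by auto
  have "(\<Sum>k<n. \<bar>a k\<bar>) = (\<Sum>k\<le>h. \<bar>a k\<bar>) + (\<Sum>k\<in>{h<..<n}. \<bar>a k\<bar>)"
    unfolding split by (rule sum.union_disjoint) auto
  also have "\<dots> = - (\<Sum>k\<le>h. a k) + (\<Sum>k\<in>{h<..<n}. a k)"
    using neg pos by (simp add: sum_negf flip: sum_negf)
  also have "\<dots> = (\<Sum>k<n. a k) - 2 * (\<Sum>k\<le>h. a k)"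
    unfolding split by (subst sum.union_disjoint) auto
  also have "\<dots> = 4 * (\<Sum>k\<le>h. cos (real k * (pi / real n))) - 4 * (real h + 1) / real n"
    unfolding total by (simp add: a_def sum_subtractf algebra_simps add_divide_distrib flip: sum_distrib_left)
  also have "(\<Sum>k\<le>h. cos (real k * (pi / real n))) = 1 / 2 + sin ((2 * real h + 1) * y) / (2 * sin y)"
    using cosk[of h] siny by (simp add: field_simps)
  \<comment> \<open>The count \<open>h + 1\<close> is n/2 or (n + 1)/2, so the subtracted term is 2
    or 2 + 2/n and cancels the leading 2. What is left is 2 cot y for even \<open>n\<close> and
    2/sin y - 2/n for odd \<open>n\<close>.\<close>
  also have "4 * (1 / 2 + sin ((2 * real h + 1) * y) / (2 * sin y)) - 4 * (real h + 1) / real n \<le> 2 / y"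
  proof (cases "even n")
    case True
    then have "2 * h + 2 = n" using n unfolding h_def by presburger
    then have h: "2 * real h + 1 = real n - 1" by linarith
    have "sin ((2 * real h + 1) * y) = cos y"
      unfolding h left_diff_distrib y(4) by (simp add: sin_diff)
    moreover have "4 * (real h + 1) / real n = 2" using h n0 by (simp add: field_simps)
    moreover have "cos y / sin y \<le> 1 / y"
      using mult_cos_le_sin[of y] y siny pi_ge_3 by (simp add: field_simps)
    ultimately show ?thesis by simp
  next
    case False
    then have "2 * h + 1 = n" unfolding h_def by presburger
    then have h: "2 * real h + 1 = real n" by linarith
    have "sin ((2 * real h + 1) * y) = 1"
      unfolding h y(4) by simp
    moreover have "4 * (real h + 1) / real n = 2 + 2 / real n" using h n0 by (simp add: field_simps)
    moreover have "1 / sin y \<le> 1 / y + 1 / real n"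
    proof -
      have "2 * y / pi = 1 / real n" by (simp add: y_def)
      then show ?thesis using inverse_sin_le[OF y(1,2)] by simp
    qed
    ultimately show ?thesis by simp
  qed
  also have "2 / y = 4 * real n / pi" using n0 by (simp add: y_def)
  finally show ?thesis by (simp add: a_def)
qed

section \<open>Laplacian energy of connected graphs and of paths\<close>

lemma (in pair_graph) card_parcs_eq_sum_out_degree:
  "card (parcs G) = (\<Sum>v\<in>pverts G. out_degree (with_proj G) v)"
proof -
  have "parcs G = (\<Union>v\<in>pverts G. out_arcs (with_proj G) v)"
    using in_arcsD1 by auto
  then have "card (parcs G) = card (\<Union>v\<in>pverts G. out_arcs (with_proj G) v)" by (rule arg_cong)
  also have "\<dots> = (\<Sum>v\<in>pverts G. card (out_arcs (with_proj G) v))"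
    using pair_finite_verts finite_out_arcs by (intro card_UN_disjoint) auto
  finally show ?thesis unfolding out_degree_def .
qed

text \<open>Following the last arc of a shortest path from a root, every other vertex contributes
  an arc towards the root and its reverse.\<close>

lemma (in pair_graph) card_parcs_ge_if_connected:
  assumes "Digraph_Component.connected (with_proj G)"
  shows "2 * (card (pverts G) - 1) \<le> card (parcs G)"
proof -
  have sym: "\<And>u v. (u, v) \<in> parcs G \<Longrightarrow> (v, u) \<in> parcs G"
    using arcs_symmetric by blast
  \<comment> \<open>Connectedness is strong connectedness of the symmetric closure, which here adds
    no arcs.\<close>
  have "parcs (mk_symmetric (with_proj G)) = parcs G"
    using sym by (auto simp: parcs_mk_symmetric)
  then have sc: "pverts G \<noteq> {}" "\<And>u v. u \<in> pverts G \<Longrightarrow> v \<in> pverts G \<Longrightarrow> (u, v) \<in> (parcs G)\<^sup>*"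
    using assms unfolding connected_def strongly_connected_def reachable_def
    by (auto dest!: rtrancl_on_rtranclI)
  obtain r where r: "r \<in> pverts G" using sc(1) by auto
  define d where "d v = (LEAST k. (r, v) \<in> parcs G ^^ k)" for v
  have d: "(r, v) \<in> parcs G ^^ d v" if "v \<in> pverts G" for v
  proof -
    have "\<exists>k. (r, v) \<in> parcs G ^^ k" using sc(2)[OF r that] by (simp add: rtrancl_power)
    then obtain k where "(r, v) \<in> parcs G ^^ k" ..
    then show ?thesis unfolding d_def by (rule LeastI)
  qed
  have "\<exists>u. (u, v) \<in> parcs G \<and> d u < d v" if v: "v \<in> pverts G - {r}" for v
  proof (cases "d v")
    case 0
    then show ?thesis using d[of v] v by auto
  next
    case (Suc k)
    then obtain u where u: "(r, u) \<in> parcs G ^^ k" "(u, v) \<in> parcs G" using d[of v] v by auto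
    then have "d u \<le> k" unfolding d_def by (intro Least_le)
    then show ?thesis using u Suc by auto
  qed
  then obtain p where p: "\<And>v. v \<in> pverts G - {r} \<Longrightarrow> (p v, v) \<in> parcs G \<and> d (p v) < d v"
    by metis
  let ?V = "pverts G - {r}"
  let ?D = "(\<lambda>v. (p v, v)) ` ?V" and ?U = "(\<lambda>v. (v, p v)) ` ?V"
  \<comment> \<open>An arc in both families would join two vertices that are each other's parent,
    yet \<open>d\<close> strictly decreases towards the parent.\<close>
  have no_common: False if "v \<in> ?V" "w \<in> ?V" "p v = w" "p w = v" for v w
    using p[OF that(1)] p[OF that(2)] unfolding that(3,4) by linarith
  have "?D \<inter> ?U = {}"
  proof (rule equals0I)
    fix e assume e: "e \<in> ?D \<inter> ?U"
    have "e \<in> ?D" using e by (rule IntD1)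
    then have 1: "snd e \<in> ?V" "p (snd e) = fst e" by auto
    have "e \<in> ?U" using e by (rule IntD2)
    then have 2: "fst e \<in> ?V" "p (fst e) = snd e" by auto
    show False by (rule no_common[OF 1(1) 2(1) 1(2) 2(2)])
  qed
  moreover have "card ?D = card ?V" "card ?U = card ?V" by (auto intro!: card_image inj_onI)
  moreover have "finite ?D" "finite ?U" using pair_finite_verts by auto
  ultimately have "card (?D \<union> ?U) = 2 * card ?V" by (simp add: card_Un_disjoint)
  moreover have "?D \<union> ?U \<subseteq> parcs G" using p sym by auto
  then have "card (?D \<union> ?U) \<le> card (parcs G)" using pair_finite_arcs by (rule card_mono[rotated])
  ultimately show ?thesis using r pair_finite_verts by simp
qed

text \<open>The degree counts the neighbours, so the diagonal term can be distributed over them. For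
  a path this leaves at most two differences per row.\<close>

lemma laplacian_mat_mult_vec:
  assumes "pair_graph G" "distinct xs" "set xs = pverts G" "i < length xs" "dim_vec v = length xs"
  shows "(laplacian_mat xs G *\<^sub>v v) $ i =
    (\<Sum>j | j < length xs \<and> (xs ! i, xs ! j) \<in> parcs G. v $ i - v $ j)"
proof -
  interpret pair_graph G by fact
  let ?N = "{j. j < length xs \<and> (xs ! i, xs ! j) \<in> parcs G}"
  have "out_arcs (with_proj G) (xs ! i) = (\<lambda>j. (xs ! i, xs ! j)) ` ?N"
    using assms(3) in_arcsD2 by (fastforce simp: out_arcs_def set_conv_nth)
  then have deg: "out_degree (with_proj G) (xs ! i) = card ?N"
    unfolding out_degree_def using assms(2)
    by (auto intro!: card_image inj_onI simp: nth_eq_iff_index_eq)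
  have "(laplacian_mat xs G *\<^sub>v v) $ i = (\<Sum>j<length xs. laplacian_mat xs G $$ (i, j) * v $ j)"
    using assms by (simp add: scalar_prod_def atLeast0LessThan)
  also have "\<dots> = (\<Sum>j<length xs. (if j = i then real (card ?N) * v $ i else 0) -
      (if j \<in> ?N then v $ j else 0))"
    using assms(4) by (intro sum.cong) (auto simp: laplacian_mat_index deg algebra_simps)
  also have "\<dots> = real (card ?N) * v $ i - (\<Sum>j\<in>?N. v $ j)"
  proof -
    have "{..<length xs} \<inter> ?N = ?N" by auto
    then show ?thesis
      using assms(4) sum.inter_restrict[of "{..<length xs}" "\<lambda>j. v $ j" ?N]
      by (simp add: sum_subtractf)
  qed
  finally show ?thesis by (simp add: sum_subtractf)
qed

section \<open>Laplacian spectrum and energy of the path\<close>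

lemma pair_graph_path_graph: "pair_graph (path_graph n)"
proof -
  have "parcs (path_graph n) \<subseteq> {0..<n} \<times> {0..<n}" by (auto simp: path_graph_def)
  then have "finite (parcs (path_graph n))" by (rule finite_subset) auto
  then show ?thesis
    by unfold_locales (auto simp: path_graph_def symmetric_def sym_def)
qed

lemma card_parcs_path_graph: "card (parcs (path_graph n)) = 2 * (n - 1)"
proof -
  have "parcs (path_graph n) = (\<lambda>i. (i, Suc i)) ` {..<n - 1} \<union> (\<lambda>i. (Suc i, i)) ` {..<n - 1}"
    by (auto simp: path_graph_def)
  moreover have "((\<lambda>i. (i, Suc i)) ` {..<n - 1}) \<inter> ((\<lambda>i. (Suc i, i)) ` {..<n - 1}) = {}" by auto
  moreover have "card ((\<lambda>i. (i, Suc i)) ` {..<n - 1}) = n - 1"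
    "card ((\<lambda>i. (Suc i, i)) ` {..<n - 1}) = n - 1" by (subst card_image; auto intro!: inj_onI)+
  ultimately show ?thesis by (simp add: card_Un_disjoint)
qed

text \<open>The eigenvector is a cosine wave sampled at half-integer positions. It is symmetric
  under reflection just outside either end, so fictitious neighbours there take the values of the
  end vertices and the recurrence for interior vertices holds everywhere.\<close>

lemma path_laplacian_eigenvalue:
  assumes "k < n"
  shows "eigenvalue (laplacian_mat [0..<n] (path_graph n)) (2 - 2 * cos (real k * (pi / real n)))"
proof -
  let ?L = "laplacian_mat [0..<n] (path_graph n)"
  define y where "y = real k * pi / (2 * real n)"
  have n: "real n > 0" using assms by simp
  have ny: "2 * real n * y = real k * pi" using n by (simp add: y_def)
  \<comment> \<open>A real argument gives meaning to the fictitious positions -1 and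
    \<open>n\<close>.\<close>
  define f where "f j = cos ((2 * j + 1) * y)" for j :: real
  define v where "v = vec n (\<lambda>j. f (real j))"
  have rec: "2 * f j - f (j - 1) - f (j + 1) = (2 - 2 * cos (2 * y)) * f j" for j
  proof -
    have "(2 * (j - 1) + 1) * y = (2 * j + 1) * y - 2 * y" "(2 * (j + 1) + 1) * y = (2 * j + 1) * y + 2 * y"
      by (simp_all add: algebra_simps)
    then have "f (j - 1) + f (j + 1) = 2 * cos (2 * y) * f j"
      unfolding f_def by (simp only: cos_add cos_diff) simp
    then show ?thesis by (simp add: algebra_simps)
  qed
  have left: "f (- 1) = f 0" by (simp add: f_def)
  have right: "f (real n) = f (real n - 1)"
  proof -
    have e: "(2 * real n + 1) * y = real k * pi + y" "(2 * (real n - 1) + 1) * y = real k * pi - y"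
      using ny by (simp_all add: algebra_simps)
    show ?thesis unfolding f_def e by (simp add: cos_add cos_diff)
  qed
  have "?L *\<^sub>v v = (2 - 2 * cos (2 * y)) \<cdot>\<^sub>v v"
  proof (rule eq_vecI)
    fix i assume "i < dim_vec ((2 - 2 * cos (2 * y)) \<cdot>\<^sub>v v)"
    then have i: "i < n" by (simp add: v_def)
    let ?N = "{j. j < n \<and> (j = Suc i \<or> i = Suc j)}"
    have "(?L *\<^sub>v v) $ i = (\<Sum>j | j < length [0..<n] \<and> ([0..<n] ! i, [0..<n] ! j) \<in> parcs (path_graph n).
        v $ i - v $ j)"
      using i by (intro laplacian_mat_mult_vec pair_graph_path_graph) (auto simp: path_graph_def v_def)
    also have "\<dots> = (\<Sum>j\<in>?N. f (real i) - f (real j))"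
      using i by (intro sum.cong) (auto simp: path_graph_def v_def)
    also have "?N = (if Suc i < n then {Suc i} else {}) \<union> (if i = 0 then {} else {i - 1})"
      using i by auto
    \<comment> \<open>The difference to a missing neighbour is 0 by \<open>left\<close> or
      \<open>right\<close>, so both differences may be written at every vertex.\<close>
    also have "(\<Sum>j\<in>\<dots>. f (real i) - f (real j)) =
        (f (real i) - f (real i + 1)) + (f (real i) - f (real i - 1))"
    proof -
      have "f (real i) = f (real i + 1)" if "\<not> Suc i < n"
      proof -
        have "real n = real i + 1" using that i by linarith
        then show ?thesis using right by simp
      qed
      moreover have "f (real i) = f (real i - 1)" if "i = 0" using that left by simp
      ultimately show ?thesis by (auto simp: add.commute of_nat_diff)
    qed
    also have "\<dots> = (2 - 2 * cos (2 * y)) * f (real i)" using rec[of "real i"] by simp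
    finally show "(?L *\<^sub>v v) $ i = ((2 - 2 * cos (2 * y)) \<cdot>\<^sub>v v) $ i" using i by (simp add: v_def)
  qed (simp add: v_def)
  \<comment> \<open>Entry 0 is \<open>cos y\<close>, which is positive because \<open>k < n\<close>
    puts \<open>y\<close> in [0, pi/2).\<close>
  moreover have "v \<noteq> 0\<^sub>v n"
  proof
    assume "v = 0\<^sub>v n"
    then have "v $ 0 = 0" using assms by simp
    then have "cos y = 0" using assms by (simp add: v_def f_def)
    moreover have "cos y > 0"
    proof (rule cos_gt_zero_pi)
      have "real k * pi < real n * pi" using assms by simp
      then show "y < pi / 2" using n by (simp add: y_def field_simps)
      have "0 \<le> y" by (simp add: y_def)
      then show "- (pi / 2) < y" using pi_half_gt_zero by linarith
    qed
    ultimately show False by simp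
  qed
  moreover have "2 * y = real k * (pi / real n)" by (simp add: y_def)
  ultimately have "eigenvector ?L v (2 - 2 * cos (real k * (pi / real n)))"
    by (simp add: eigenvector_def v_def)
  then show ?thesis unfolding eigenvalue_def by blast
qed

text \<open>The cosine is injective on [0, pi], so \<open>n\<close> distinct eigenvalues are known.
  The spectrum has size \<open>n\<close>, hence it contains nothing else and each has multiplicity
  one.\<close>

theorem laplacian_spectrum_path_graph:
  "laplacian_spectrum (path_graph n) =
    image_mset (\<lambda>k. 2 - 2 * cos (real k * (pi / real n))) (mset_set {..<n})"
proof -
  let ?r = "\<lambda>k. 2 - 2 * cos (real k * (pi / real n))"
  let ?L = "laplacian_mat [0..<n] (path_graph n)"
  have L: "?L \<in> carrier_mat n n" using laplacian_mat_carrier[of "[0..<n]"] by simp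
  have inj: "inj_on ?r {..<n}"
  proof (rule inj_onI)
    fix i j assume ij: "i \<in> {..<n}" "j \<in> {..<n}" "?r i = ?r j"
    have "real i * (pi / real n) \<le> pi" "real j * (pi / real n) \<le> pi"
      using ij(1,2) by (auto simp: field_simps)
    moreover have "0 \<le> real i * (pi / real n)" "0 \<le> real j * (pi / real n)" by simp_all
    moreover have "cos (real i * (pi / real n)) = cos (real j * (pi / real n))" using ij(3) by linarith
    ultimately have "real i * (pi / real n) = real j * (pi / real n)" by (metis cos_inj_pi)
    then show "i = j" using ij(1) by simp
  qed
  have S: "laplacian_spectrum (path_graph n) = proots (char_poly ?L)"
    by (rule laplacian_spectrum_eq) (auto simp: path_graph_def)
  have cp: "char_poly ?L \<noteq> 0" using degree_monic_char_poly[OF L] by auto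
  have "mset_set (?r ` {..<n}) \<subseteq># proots (char_poly ?L)"
  proof (rule mset_subset_eqI)
    fix x
    show "count (mset_set (?r ` {..<n})) x \<le> count (proots (char_poly ?L)) x"
    proof (cases "x \<in> ?r ` {..<n}")
      case True
      then have "poly (char_poly ?L) x = 0"
        using path_laplacian_eigenvalue eigenvalue_root_char_poly[OF L] by blast
      then have "x \<in># proots (char_poly ?L)" using cp by simp
      then have "1 \<le> count (proots (char_poly ?L)) x" by (simp only: count_greater_eq_one_iff)
      then show ?thesis using True by simp
    qed simp
  qed
  moreover have "size (proots (char_poly ?L)) = n"
    using size_laplacian_spectrum[OF pair_graph_path_graph, of n] S by (simp add: path_graph_def)
  moreover have "size (mset_set (?r ` {..<n})) = n" using inj by (simp add: card_image)
  ultimately have "mset_set (?r ` {..<n}) = proots (char_poly ?L)"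
    by (metis mset_subset_size subset_mset.less_le nat_less_le)
  then show ?thesis using S image_mset_mset_set[OF inj] by simp
qed

lemma laplacian_energy_path_graph:
  assumes "n > 0"
  shows "laplacian_energy (path_graph n) = (\<Sum>k<n. \<bar>2 / real n - 2 * cos (real k * (pi / real n))\<bar>)"
proof -
  have "average_degree (path_graph n) = 2 - 2 / real n"
    using assms unfolding average_degree_def card_parcs_path_graph
    by (simp add: path_graph_def of_nat_diff field_simps)
  then have avg: "x - average_degree (path_graph n) = x - (2 - 2 / real n)" for x by simp
  have "laplacian_energy (path_graph n) = (\<Sum>k<n. \<bar>2 - 2 * cos (real k * (pi / real n)) - (2 - 2 / real n)\<bar>)"
    unfolding laplacian_energy_def laplacian_spectrum_path_graph avg
    by (simp add: sum_unfold_sum_mset image_mset.compositionality o_def)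
  also have "\<dots> = (\<Sum>k<n. \<bar>2 / real n - 2 * cos (real k * (pi / real n))\<bar>)"
    by (intro sum.cong arg_cong[of _ _ abs]) simp_all
  finally show ?thesis .
qed

section \<open>Lower bound for the energy from the vertex degrees\<close>

text \<open>The Laplacian diagonal consists of the degrees, so their absolute deviations from the
  mean bound the energy from below. Replacing each absolute value by the deviation itself on
  internal vertices and by its negative on pendent ones only lowers the sum. All deviations add up
  to 0, so both groups contribute the same amount, \<open>(n - s) * (?c - 1)\<close>.\<close>

lemma laplacian_energy_ge:
  assumes "pair_graph G" "Digraph_Component.connected (with_proj G)"
  defines "n \<equiv> real (card (pverts G))" and "s \<equiv> real (card (internal_verts G))"
  shows "2 * (n - s) * (1 - 2 / n) \<le> laplacian_energy G"
proof -
  interpret pair_graph G by fact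
  let ?deg = "\<lambda>v. real (out_degree (with_proj G) v)" and ?I = "internal_verts G"
  let ?m = "real (card (parcs G))"
  let ?xs = "vertex_enum G"
  let ?c = "average_degree G"
  note xs = vertex_enum[OF pair_finite_verts]
  have c: "?c = ?m / n" by (simp add: average_degree_def n_def)
  have "pverts G \<noteq> {}"
    using assms(2) by (simp add: connected_def strongly_connected_def)
  then have n0: "n \<ge> 1" using pair_finite_verts by (simp add: n_def Suc_le_eq card_gt_0_iff)
  have "2 * (n - 1) \<le> ?m"
  proof -
    have "1 \<le> card (pverts G)" using n0 unfolding n_def by linarith
    then have "2 * card (pverts G) \<le> card (parcs G) + 2"
      using card_parcs_ge_if_connected[OF assms(2)] by linarith
    then have "real (2 * card (pverts G)) \<le> real (card (parcs G) + 2)" by (rule of_nat_mono)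
    then show ?thesis by (simp add: n_def)
  qed
  then have "2 * (n - 1) / n \<le> ?m / n" using n0 by (intro divide_right_mono) auto
  moreover have "2 * (n - 1) / n = 2 - 2 / n" using n0 by (simp add: field_simps)
  ultimately have c_ge: "2 - 2 / n \<le> ?c" by (simp add: c)
  have I: "?I \<subseteq> pverts G" by (auto simp: internal_verts_def)
  then have finI: "finite ?I" and s: "s \<le> n"
    using pair_finite_verts by (auto simp: s_def n_def card_mono intro: finite_subset)
  have cardP: "real (card (pverts G - ?I)) = n - s"
    using I finI pair_finite_verts by (simp add: card_Diff_subset of_nat_diff card_mono n_def s_def)
  have pendent: "?deg v = 1" if "v \<in> pverts G - ?I" for v
    using that by (simp add: internal_verts_def)
  have "?m = (\<Sum>v\<in>?I. ?deg v) + (\<Sum>v\<in>pverts G - ?I. ?deg v)"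
    unfolding card_parcs_eq_sum_out_degree of_nat_sum
    using sum.subset_diff[OF I pair_finite_verts, of ?deg] by simp
  also have "(\<Sum>v\<in>pverts G - ?I. ?deg v) = n - s" using pendent cardP by simp
  finally have degI: "(\<Sum>v\<in>?I. ?deg v) = ?m - (n - s)" by simp
  have "2 * (n - s) * (1 - 2 / n) \<le> 2 * (n - s) * (?c - 1)"
    using s c_ge by (intro mult_left_mono) auto
  also have "\<dots> = (\<Sum>v\<in>?I. ?deg v - ?c) + (\<Sum>v\<in>pverts G - ?I. ?c - ?deg v)"
  proof -
    have "(\<Sum>v\<in>pverts G - ?I. ?c - ?deg v) = (n - s) * (?c - 1)"
      using pendent cardP by simp
    moreover have "(\<Sum>v\<in>?I. ?deg v - ?c) = ?m - (n - s) - s * ?c"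
      by (simp add: sum_subtractf degI s_def)
    moreover have "?m = n * ?c" using n0 by (simp add: c)
    ultimately show ?thesis by (simp add: algebra_simps)
  qed
  also have "\<dots> \<le> (\<Sum>v\<in>?I. \<bar>?deg v - ?c\<bar>) + (\<Sum>v\<in>pverts G - ?I. \<bar>?deg v - ?c\<bar>)"
    by (intro add_mono sum_mono) auto
  also have "\<dots> = (\<Sum>v\<in>pverts G. \<bar>?deg v - ?c\<bar>)"
    using sum.subset_diff[OF I pair_finite_verts, of "\<lambda>v. \<bar>?deg v - ?c\<bar>"] by simp
  also have "\<dots> = (\<Sum>i<length ?xs. \<bar>laplacian_mat ?xs G $$ (i, i) - ?c\<bar>)"
  proof -
    have "bij_betw ((!) ?xs) {..<length ?xs} (pverts G)"
      using xs by (intro bij_betw_nth) auto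
    moreover have "laplacian_mat ?xs G $$ (i, i) = ?deg (?xs ! i)" if "i < length ?xs" for i
      using that no_loops' by (auto simp: laplacian_mat_index)
    ultimately show ?thesis by (subst sum.reindex_bij_betw[symmetric]) auto
  qed
  also have "\<dots> \<le> laplacian_energy G"
    unfolding laplacian_energy_def laplacian_spectrum_def
    by (intro sum_abs_diag_le_sum_abs_eigenvalues laplacian_mat_symmetric assms(1)) simp
  finally show ?thesis .
qed

theorem theorem3p2:
  fixes T :: "'a pair_pre_digraph" and n s :: nat
  assumes "ugraph_tree T"
    and "card (pverts T) = n"
    and "n \<ge> 4"
    and "card (internal_verts T) = s"
    and "((pi - 2) / pi) * real n \<ge> real s + 2 - 2 * real s / real n"
  shows "laplacian_energy T \<ge> laplacian_energy (path_graph n)"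
proof -
  have n0: "real n > 0" using assms(3) by simp
  have "laplacian_energy (path_graph n) \<le> 4 * real n / pi"
    using laplacian_energy_path_graph path_spectrum_abs_sum_le assms(3) by simp
  \<comment> \<open>Written this way the left side of the hypothesis on \<open>s\<close> appears;
    after it is applied, n - s - 2 + 2s/n factors as (n - s)(1 - 2/n).\<close>
  also have "\<dots> = 2 * (real n - ((pi - 2) / pi) * real n)" by (simp add: field_simps)
  also have "\<dots> \<le> 2 * (real n - (real s + 2 - 2 * real s / real n))" using assms(5) by simp
  also have "\<dots> = 2 * (real n - real s) * (1 - 2 / real n)" using n0 by (simp add: field_simps)
  also have "\<dots> \<le> laplacian_energy T"
    using laplacian_energy_ge[of T] assms(1,2,4) by (simp add: ugraph_tree_def)
  finally show ?thesis .
qed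

end
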